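(* Let $k\ge1$. The intersection ring $\mathcal{A}^*(\bigwedge^kM,D)$ is the polynomial ring $\mathbb{Z}[D_1,\ldots,D_k]$.
   Context: $M=\bigoplus_{i\ge1}\mathbb{Z}\epsilon^i$ is the free $\mathbb{Z}$-module with basis $(\epsilon^1,\epsilon^2,\ldots)$, and for $j\ge0$ the endomorphism $D_j$ of $M$ is given by $D_j\epsilon^i=\epsilon^{i+j}$; put $D_t=\sum_{j\ge0}D_jt^j$. $D_t$ is extended to $D_t=\sum_{j\ge 0} D_jt^j:\bigwedge M\to(\bigwedge M)[[t]]$ by requiring it to be a $\mathbb{Z}$-algebra homomorphism, i.e. $D_t(\alpha\wedge\beta)=D_t\alpha\wedge D_t\beta$. Its coefficients $D_j$ preserve each $\bigwedge^kM$ and commute pairwise there. The intersection ring $\mathcal{A}^*(\bigwedge^kM,D)$ is the commutative subring $\mathbb{Z}[D]$ of $\mathrm{End}_{\mathbb{Z}}(\bigwedge^kM)$ generated by all $D_1,D_2,\ldots$; equivalently it is $\mathbb{Z}[T_1,T_2,\ldots]/\ker(E)$, where $E(P)=P(D_1,D_2,\ldots)\cdot(\epsilon^1\wedge\cdots\wedge\epsilon^k)$. The claim means that this ring is generated by $D_1,\ldots,D_k$ and that these are algebraically independent over $\mathbb{Z}$. *)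

theory Defs
  imports
    "HOL-Library.Poly_Mapping"
    "HOL-Computational_Algebra.Formal_Power_Series"
    "HOL-Algebra.Generated_Rings"
begin

text \<open>
  The free module \<open>M\<close> is \<open>nat \<Rightarrow>\<^sub>0 int\<close>.  Indices are shifted by one: \<open>frag_of n\<close> is the basis
  vector \<open>\<epsilon>\<close> with superscript \<open>n + 1\<close>, so that no condition \<open>i \<ge> 1\<close> has to be carried around.
\<close>

definition eps :: "nat \<Rightarrow> nat \<Rightarrow>\<^sub>0 int" where
  "eps i = frag_of (i - 1)"

definition shift :: "nat \<Rightarrow> (nat \<Rightarrow>\<^sub>0 int) \<Rightarrow> nat \<Rightarrow>\<^sub>0 int" where
  "shift j = frag_extend (\<lambda>n. frag_of (n + j))"

lemma shift_eps: "i \<ge> 1 \<Longrightarrow> shift j (eps i) = eps (i + j)"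
  by (simp add: shift_def eps_def)

datatype word = Word (letters: "nat list")

instantiation word :: monoid_add
begin
definition zero_word :: word where "zero_word = Word []"
definition plus_word :: "word \<Rightarrow> word \<Rightarrow> word" where
  "plus_word u v = Word (letters u @ letters v)"
instance
  by standard (auto simp: zero_word_def plus_word_def)
end

text \<open>
  The tensor algebra of the free module \<open>M\<close> is the free associative ring on the basis of \<open>M\<close>,
  that is, the monoid ring of the free monoid of words in the basis vectors.
\<close>

type_synonym tensor = "word \<Rightarrow>\<^sub>0 int"

definition vec :: "(nat \<Rightarrow>\<^sub>0 int) \<Rightarrow> tensor" where
  "vec = frag_extend (\<lambda>n. frag_of (Word [n]))"

text \<open>The two-sided ideal generated by all \<open>m \<otimes> m\<close> with \<open>m \<in> M\<close>.\<close>

inductive_set alt_ideal :: "tensor set" where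
  zero: "0 \<in> alt_ideal"
| step: "t \<in> alt_ideal \<Longrightarrow> t + u * vec m * vec m * v \<in> alt_ideal"

lemma alt_ideal_add:
  assumes "s \<in> alt_ideal" "t \<in> alt_ideal"
  shows "s + t \<in> alt_ideal"
  using assms(2)
  by (induction) (use assms(1) alt_ideal.step in \<open>auto simp: add.assoc[symmetric]\<close>)

lemma alt_ideal_uminus: "t \<in> alt_ideal \<Longrightarrow> - t \<in> alt_ideal"
proof (induction rule: alt_ideal.induct)
  case (step t u m v)
  then have "- t + (- u) * vec m * vec m * v \<in> alt_ideal"
    by (intro alt_ideal.step)
  then show ?case by simp
qed (simp add: alt_ideal.zero)

lemma alt_ideal_mult_left: "t \<in> alt_ideal \<Longrightarrow> s * t \<in> alt_ideal"
proof (induction rule: alt_ideal.induct)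
  case (step t u m v)
  then have "s * t + (s * u) * vec m * vec m * v \<in> alt_ideal"
    by (intro alt_ideal.step)
  then show ?case by (simp add: distrib_left mult.assoc)
qed (simp add: alt_ideal.zero)

lemma alt_ideal_mult_right: "t \<in> alt_ideal \<Longrightarrow> t * s \<in> alt_ideal"
proof (induction rule: alt_ideal.induct)
  case (step t u m v)
  then have "t * s + u * vec m * vec m * (v * s) \<in> alt_ideal"
    by (intro alt_ideal.step)
  then show ?case by (simp add: distrib_right mult.assoc)
qed (simp add: alt_ideal.zero)

definition ext_rel :: "tensor \<Rightarrow> tensor \<Rightarrow> bool" where
  "ext_rel s t \<longleftrightarrow> s - t \<in> alt_ideal"

lemma equivp_ext_rel: "equivp ext_rel"
proof (rule equivpI)
  show "reflp ext_rel"
    by (simp add: reflp_def ext_rel_def alt_ideal.zero)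
  show "symp ext_rel"
    unfolding symp_def ext_rel_def by (metis alt_ideal_uminus minus_diff_eq)
  show "transp ext_rel"
    unfolding transp_def ext_rel_def
    by (metis (no_types, lifting) alt_ideal_add diff_add_cancel add_diff_eq)
qed

text \<open>The exterior algebra of \<open>M\<close>; its multiplication \<open>*\<close> is the wedge product.\<close>

quotient_type ext = tensor / ext_rel
  morphisms rep_ext wedge_of
  by (rule equivp_ext_rel)

lemma lookup_mult_empty:
  "Poly_Mapping.lookup ((s::tensor) * t) (Word []) = Poly_Mapping.lookup s (Word []) * Poly_Mapping.lookup t (Word [])"
proof -
  have "(\<Sum>q. Poly_Mapping.lookup t q when Word [] = l + q)
      = (Poly_Mapping.lookup t (Word []) when l = Word [])" for l
  proof (cases "l = Word []")
    case True
    then have "Word [] = l + q \<longleftrightarrow> Word [] = q" for q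
      by (cases q) (simp add: plus_word_def)
    then show ?thesis using True by simp
  next
    case False
    then have "Word [] \<noteq> l + q" for q
      by (cases l) (simp add: plus_word_def)
    then show ?thesis using False by simp
  qed
  then show ?thesis
    by (simp add: lookup_mult mult_when)
qed

lemma lookup_vec_empty: "Poly_Mapping.lookup (vec m) (Word []) = 0"
  unfolding vec_def frag_extend_def
  by (simp add: lookup_sum)

lemma one_notin_alt_ideal: "1 \<notin> alt_ideal"
proof -
  have "Poly_Mapping.lookup t (Word []) = 0" if "t \<in> alt_ideal" for t
    using that
    by (induction) (simp_all add: lookup_add lookup_mult_empty lookup_vec_empty)
  moreover have "Poly_Mapping.lookup (1::tensor) (Word []) = 1"
    by (simp add: lookup_one zero_word_def)
  ultimately show ?thesis by fastforce
qed

instantiation ext :: ring_1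
begin

lift_definition zero_ext :: ext is 0 .
lift_definition one_ext :: ext is 1 .
lift_definition plus_ext :: "ext \<Rightarrow> ext \<Rightarrow> ext" is "(+)"
  unfolding ext_rel_def using alt_ideal_add by (metis add_diff_add)
lift_definition uminus_ext :: "ext \<Rightarrow> ext" is uminus
  unfolding ext_rel_def using alt_ideal_uminus by (metis minus_diff_minus)
lift_definition minus_ext :: "ext \<Rightarrow> ext \<Rightarrow> ext" is "(-)"
  unfolding ext_rel_def
proof -
  fix a b c d :: tensor
  assume "a - b \<in> alt_ideal" "c - d \<in> alt_ideal"
  then have "(a - b) + - (c - d) \<in> alt_ideal"
    by (intro alt_ideal_add alt_ideal_uminus)
  then show "a - c - (b - d) \<in> alt_ideal"
    by (simp add: algebra_simps)
qed
lift_definition times_ext :: "ext \<Rightarrow> ext \<Rightarrow> ext" is "(*)"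
  unfolding ext_rel_def
proof -
  fix a b c d :: tensor
  assume "a - b \<in> alt_ideal" "c - d \<in> alt_ideal"
  then have "(a - b) * c + b * (c - d) \<in> alt_ideal"
    by (intro alt_ideal_add alt_ideal_mult_left alt_ideal_mult_right)
  then show "a * c - b * d \<in> alt_ideal"
    by (simp add: algebra_simps)
qed

instance
proof
  show "(0::ext) \<noteq> 1"
    by transfer (use alt_ideal_uminus one_notin_alt_ideal in \<open>fastforce simp: ext_rel_def\<close>)
qed (transfer; simp add: ext_rel_def algebra_simps alt_ideal.zero)+

end

definition iota :: "(nat \<Rightarrow>\<^sub>0 int) \<Rightarrow> ext" where
  "iota m = wedge_of (vec m)"

text \<open>The exterior power of degree \<open>k\<close> is the image of the homogeneous tensors of degree \<open>k\<close>.\<close>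

definition ext_power :: "nat \<Rightarrow> ext set" where
  "ext_power k = wedge_of ` {t. \<forall>w\<in>Poly_Mapping.keys t. length (letters w) = k}"


definition is_ring_hom :: "('a::ring_1 \<Rightarrow> 'b::ring_1) \<Rightarrow> bool" where
  "is_ring_hom f \<longleftrightarrow> f 1 = 1 \<and> (\<forall>x y. f (x + y) = f x + f y) \<and> (\<forall>x y. f (x * y) = f x * f y)"

definition is_D_series :: "(ext \<Rightarrow> ext fps) \<Rightarrow> bool" where
  "is_D_series f \<longleftrightarrow> is_ring_hom f \<and> (\<forall>m. f (iota m) = Abs_fps (\<lambda>j. iota (shift j m)))"

text \<open>
  The extension of the shifts to a ring homomorphism exists and is unique, see \<open>ex1_D_series\<close> below.
\<close>

definition D_series :: "ext \<Rightarrow> ext fps" where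
  "D_series = (THE f. is_D_series f)"

definition D :: "nat \<Rightarrow> ext \<Rightarrow> ext" where
  "D j x = fps_nth (D_series x) j"

lemma wedge_of_simps:
  "wedge_of 0 = 0" "wedge_of 1 = 1" "wedge_of (s + t) = wedge_of s + wedge_of t"
  "wedge_of (s - t) = wedge_of s - wedge_of t" "wedge_of (s * t) = wedge_of s * wedge_of t"
  by (simp_all add: zero_ext.abs_eq one_ext.abs_eq plus_ext.abs_eq minus_ext.abs_eq
      times_ext.abs_eq)

lemma wedge_of_eq_0: "t \<in> alt_ideal \<Longrightarrow> wedge_of t = 0"
  by (simp add: zero_ext.abs_eq ext.abs_eq_iff ext_rel_def)

lemma iota_square: "iota m * iota m = 0"
  using wedge_of_eq_0[OF alt_ideal.step[OF alt_ideal.zero, of 1 m 1]]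
  by (simp add: iota_def wedge_of_simps)

lemma vec_add: "vec (m + m') = vec m + vec m'"
  by (simp add: vec_def frag_extend_add)

lemma iota_add: "iota (m + m') = iota m + iota m'"
  by (simp add: iota_def wedge_of_simps vec_add)

lemma iota_anticommute: "iota m * iota m' = - (iota m' * iota m)"
  using iota_square[of "m + m'"]
  by (simp add: iota_add algebra_simps iota_square eq_neg_iff_add_eq_0)

lemma iota_frag_of: "iota (frag_of n) = wedge_of (frag_of (Word [n]))"
  by (simp add: iota_def vec_def)

lemma frag_of_Word_Cons: "frag_of (Word (n # l)) = frag_of (Word [n]) * frag_of (Word l)"
  by (simp add: mult_single plus_word_def)

lemma frag_of_Word_Nil: "frag_of (Word []) = 1"
  by (metis single_one zero_word_def)

lemma frag_induct [case_names zero frag diff]: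
  assumes "P 0" "\<And>n. P (frag_of n)" "\<And>x y. P x \<Longrightarrow> P y \<Longrightarrow> P (x - y)"
  shows "P (m :: 'a \<Rightarrow>\<^sub>0 int)"
  by (rule frag_induction[OF subset_UNIV]) (use assms in auto)

lemma tensor_induct [case_names zero one vec mult diff]:
  assumes "P 0" "P 1" "\<And>n. P (frag_of (Word [n]))" "\<And>s t. P s \<Longrightarrow> P t \<Longrightarrow> P (s * t)"
    "\<And>s t. P s \<Longrightarrow> P t \<Longrightarrow> P (s - t)"
  shows "P (t :: tensor)"
proof -
  have *: "P (frag_of (Word l))" for l
  proof (induction l)
    case Nil
    show ?case unfolding frag_of_Word_Nil by (rule assms(2))
  next
    case (Cons n l)
    show ?case unfolding frag_of_Word_Cons[of n l] by (intro assms(3,4) Cons.IH)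
  qed
  show ?thesis
  proof (induction t rule: frag_induct)
    case (frag x)
    then show ?case using * by (cases x) simp
  qed (use assms in auto)
qed

lemma ext_induct [case_names zero one iota mult diff]:
  assumes "P 0" "P 1" "\<And>m. P (iota m)" "\<And>x y. P x \<Longrightarrow> P y \<Longrightarrow> P (x * y)"
    "\<And>x y. P x \<Longrightarrow> P y \<Longrightarrow> P (x - y)"
  shows "P (x :: ext)"
proof (induction x)
  case (1 t)
  show ?case
  proof (induction t rule: tensor_induct)
    case (vec n)
    show ?case using assms(3)[of "frag_of n"] by (simp only: iota_frag_of)
  qed (simp_all only: wedge_of_simps assms)
qed

lemma is_ring_hom_0: "is_ring_hom f \<Longrightarrow> f 0 = 0"
  unfolding is_ring_hom_def by (metis add_cancel_right_right)

lemma is_ring_hom_diff: "is_ring_hom f \<Longrightarrow> f (x - y) = f x - f y"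
  unfolding is_ring_hom_def by (metis add_diff_cancel diff_add_cancel)

lemma is_D_series_unique:
  assumes "is_D_series f" "is_D_series g"
  shows "f = g"
proof
  fix x
  show "f x = g x"
    by (induction x rule: ext_induct)
      (use assms in \<open>simp_all add: is_D_series_def is_ring_hom_0 is_ring_hom_diff is_ring_hom_def[of f]
          is_ring_hom_def[of g]\<close>)
qed


definition word_series :: "word \<Rightarrow> ext fps" where
  "word_series w = prod_list (map (\<lambda>n. Abs_fps (\<lambda>j. iota (frag_of (n + j)))) (letters w))"

definition tensor_series :: "tensor \<Rightarrow> ext fps" where
  "tensor_series t =
    (\<Sum>w\<in>Poly_Mapping.keys t. of_int (Poly_Mapping.lookup t w) * word_series w)"

lemma tensor_series_superset:
  assumes "finite A" "Poly_Mapping.keys t \<subseteq> A"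
  shows "tensor_series t = (\<Sum>w\<in>A. of_int (Poly_Mapping.lookup t w) * word_series w)"
  unfolding tensor_series_def
  using assms by (intro sum.mono_neutral_left) (auto simp: in_keys_iff)

lemma tensor_series_diff: "tensor_series (s - t) = tensor_series s - tensor_series t"
proof -
  let ?A = "Poly_Mapping.keys s \<union> Poly_Mapping.keys t"
  have "Poly_Mapping.keys (s - t) \<subseteq> ?A"
    by (rule keys_diff)
  then show ?thesis
    by (simp add: tensor_series_superset[of ?A] lookup_minus left_diff_distrib sum_subtractf)
qed

lemma tensor_series_0: "tensor_series 0 = 0"
  by (simp add: tensor_series_def)

lemma tensor_series_add: "tensor_series (s + t) = tensor_series s + tensor_series t"
  using tensor_series_diff[of s "0 - t"] tensor_series_diff[of 0 t]
  by (simp add: tensor_series_0)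

lemma tensor_series_frag_of: "tensor_series (frag_of w) = word_series w"
  by (simp add: tensor_series_def keys_frag_of)

lemma word_series_add: "word_series (u + v) = word_series u * word_series v"
  by (simp add: word_series_def plus_word_def)

lemma tensor_series_mult: "tensor_series (s * t) = tensor_series s * tensor_series t"
proof (induction s rule: frag_induct)
  case (frag u)
  show ?case
  proof (induction t rule: frag_induct)
    case (frag v)
    show ?case
      by (simp only: mult_single tensor_series_frag_of word_series_add mult_1)
  qed (simp_all add: tensor_series_0 tensor_series_diff right_diff_distrib)
qed (simp_all add: tensor_series_0 tensor_series_diff left_diff_distrib)

lemma iota_0: "iota 0 = 0"
  by (simp add: iota_def vec_def wedge_of_simps)

lemma iota_diff: "iota (x - y) = iota x - iota y"
  by (simp add: iota_def vec_def frag_extend_diff wedge_of_simps)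

lemma tensor_series_vec: "tensor_series (vec m) = Abs_fps (\<lambda>j. iota (shift j m))"
proof (induction m rule: frag_induct)
  case zero
  show ?case
    by (simp add: vec_def tensor_series_0 shift_def iota_0 fps_zero_def)
next
  case (frag n)
  show ?case
    by (simp only: vec_def frag_extend_of tensor_series_frag_of word_series_def shift_def
        word.sel list.map prod_list.Cons prod_list.Nil mult_1_right)
next
  case (diff x y)
  then show ?case
    by (simp add: vec_def frag_extend_diff tensor_series_diff shift_def iota_diff fps_eq_iff)
qed

lemma convolution_square_eq_0:
  fixes a :: "nat \<Rightarrow> 'a::ring_1"
  assumes "\<And>i. a i * a i = 0" "\<And>i j. a i * a j = - (a j * a i)"
  shows "(\<Sum>i=0..n. a i * a (n - i)) = 0"
  using assms
proof (induction n arbitrary: a rule: less_induct)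
  case (less n)
  consider "n = 0" | "n = 1" | m where "n = Suc (Suc m)"
    by (metis One_nat_def not0_implies_Suc)
  then show ?case
  proof cases
    case 1
    then show ?thesis using less.prems(1) by simp
  next
    case 2
    then show ?thesis using less.prems(2)[of 0 1] by simp
  next
    case 3
    have *: "(\<Sum>i=0..m. a (Suc i) * a (Suc (m - i))) = 0"
      by (rule less.IH) (simp add: 3, rule less.prems(1), rule less.prems(2))
    have "(\<Sum>i=0..n. a i * a (n - i)) =
        a 0 * a n + (\<Sum>i=0..m. a (Suc i) * a (n - Suc i)) + a n * a 0"
      unfolding 3
      by (subst sum.atLeast0_atMost_Suc_shift, subst sum.atLeast0_atMost_Suc) simp
    also have "(\<Sum>i=0..m. a (Suc i) * a (n - Suc i)) = (\<Sum>i=0..m. a (Suc i) * a (Suc (m - i)))"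
      by (intro sum.cong) (auto simp: 3 Suc_diff_le)
    finally show ?thesis
      using less.prems(2)[of 0 n] * by simp
  qed
qed

lemma tensor_series_alt_ideal: "t \<in> alt_ideal \<Longrightarrow> tensor_series t = 0"
proof (induction rule: alt_ideal.induct)
  case (step t u m v)
  have "tensor_series (vec m) * tensor_series (vec m) = 0"
    unfolding fps_eq_iff tensor_series_vec fps_mult_nth fps_nth_Abs_fps
    using convolution_square_eq_0[of "\<lambda>j. iota (shift j m)", OF iota_square iota_anticommute]
    by simp
  then show ?case
    using step by (simp add: tensor_series_add tensor_series_mult mult.assoc)
      (simp flip: mult.assoc)
qed (rule tensor_series_0)

theorem ex1_D_series: "\<exists>!f. is_D_series f"
proof (rule ex_ex1I)
  define f where "f x = tensor_series (rep_ext x)" for x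
  have f: "f (wedge_of t) = tensor_series t" for t
  proof -
    have "ext_rel (rep_ext (wedge_of t)) t"
      by (metis Quotient3_abs_rep Quotient3_ext ext.abs_eq_iff)
    then show ?thesis
      using tensor_series_alt_ideal tensor_series_diff
      unfolding f_def ext_rel_def by (metis eq_iff_diff_eq_0)
  qed
  have ex: "\<exists>t. x = wedge_of t" for x
    by (metis Quotient3_abs_rep Quotient3_ext)
  have "f 1 = 1"
    using f[of 1] tensor_series_frag_of[of "Word []"]
    unfolding frag_of_Word_Nil wedge_of_simps by (simp add: word_series_def)
  moreover have "f (x + y) = f x + f y" "f (x * y) = f x * f y" for x y
    using ex[of x] ex[of y]
    by (metis f wedge_of_simps(3) tensor_series_add, metis f wedge_of_simps(5) tensor_series_mult)
  moreover have "f (iota m) = Abs_fps (\<lambda>j. iota (shift j m))" for m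
    unfolding iota_def f tensor_series_vec ..
  ultimately show "\<exists>f. is_D_series f"
    unfolding is_D_series_def is_ring_hom_def by blast
qed (rule is_D_series_unique)

lemma D_series: "is_D_series D_series"
  unfolding D_series_def by (rule theI'[OF ex1_D_series])

lemma D_iota: "D j (iota m) = iota (shift j m)"
  using D_series by (simp add: D_def is_D_series_def)

lemma D_eps: "i \<ge> 1 \<Longrightarrow> D j (iota (eps i)) = iota (eps (i + j))"
  by (simp add: D_iota shift_eps)

lemma D_add: "D j (x + y) = D j x + D j y"
  using D_series by (simp add: D_def is_D_series_def is_ring_hom_def)

lemma D_0: "D j 0 = 0"
  using D_series by (simp add: D_def is_D_series_def is_ring_hom_0)

lemma D_diff: "D j (x - y) = D j x - D j y"
  using D_series by (simp add: D_def is_D_series_def is_ring_hom_diff)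

lemma D_sum: "D j (\<Sum>i\<in>A. f i) = (\<Sum>i\<in>A. D j (f i))"
  by (induction A rule: infinite_finite_induct) (simp_all add: D_0 D_add)

lemma D_one: "D j 1 = (if j = 0 then 1 else 0)"
  using D_series by (simp add: D_def is_D_series_def is_ring_hom_def)

lemma D_mult: "D j (x * y) = (\<Sum>i=0..j. D i x * D (j - i) y)"
  using D_series by (simp add: D_def is_D_series_def is_ring_hom_def fps_mult_nth)

lemma shift_shift: "shift i (shift j m) = shift (i + j) m"
proof (induction m rule: frag_induct)
  case zero
  show ?case by (simp add: shift_def)
next
  case (frag n)
  show ?case
    unfolding shift_def frag_extend_of by (simp add: add_ac)
next
  case (diff x y)
  then show ?case by (simp add: shift_def frag_extend_diff)
qed

lemma D_commute: "D i (D j x) = D j (D i x)"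
proof (induction x arbitrary: i j rule: ext_induct)
  case one
  show ?case by (simp add: D_one D_0)
next
  case (iota m)
  show ?case by (simp add: D_iota shift_shift add.commute)
next
  case (mult x y)
  have *: "D i (D j (x * y)) =
      (\<Sum>a=0..j. \<Sum>b=0..i. D b (D a x) * D (i - b) (D (j - a) y))" for i j
    by (simp add: D_mult D_sum)
  show ?case
    unfolding *[of i j] *[of j i]
  proof (subst sum.swap, intro sum.cong refl)
    fix a b
    show "D b (D a x) * D (i - b) (D (j - a) y) = D a (D b x) * D (j - a) (D (i - b) y)"
      using mult.IH(1)[of b a] mult.IH(2)[of "i - b" "j - a"] by (rule arg_cong2)
  qed
qed (simp_all add: D_0 D_diff)

lemma zero_in_ext_power: "0 \<in> ext_power k"
  unfolding ext_power_def by (rule image_eqI[of _ _ 0]) (simp_all add: wedge_of_simps)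

lemma ext_power_diff:
  assumes "x \<in> ext_power k" "y \<in> ext_power k"
  shows "x - y \<in> ext_power k"
proof -
  obtain s t where "x = wedge_of s" "y = wedge_of t"
    and st: "\<forall>w\<in>Poly_Mapping.keys s. length (letters w) = k"
      "\<forall>w\<in>Poly_Mapping.keys t. length (letters w) = k"
    using assms unfolding ext_power_def by blast
  then have "x - y = wedge_of (s - t)"
    by (simp add: wedge_of_simps)
  moreover have "\<forall>w\<in>Poly_Mapping.keys (s - t). length (letters w) = k"
    using keys_diff[of s t] st by blast
  ultimately show ?thesis unfolding ext_power_def by blast
qed

lemma ext_power_uminus: "x \<in> ext_power k \<Longrightarrow> - x \<in> ext_power k"
  using ext_power_diff[OF zero_in_ext_power] by fastforce

lemma ext_power_add:
  assumes "x \<in> ext_power k" "y \<in> ext_power k"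
  shows "x + y \<in> ext_power k"
  using ext_power_diff[OF assms(1) ext_power_uminus[OF assms(2)]] by simp

lemma ext_power_sum: "(\<And>i. i \<in> A \<Longrightarrow> f i \<in> ext_power k) \<Longrightarrow> (\<Sum>i\<in>A. f i) \<in> ext_power k"
  by (induction A rule: infinite_finite_induct) (auto simp: zero_in_ext_power ext_power_add)

lemma ext_power_induct [consumes 1, case_names zero word diff]:
  assumes "x \<in> ext_power k" "P 0" "\<And>l. length l = k \<Longrightarrow> P (wedge_of (frag_of (Word l)))"
    "\<And>x y. P x \<Longrightarrow> P y \<Longrightarrow> P (x - y)"
  shows "P x"
proof -
  obtain t where t: "x = wedge_of t" "Poly_Mapping.keys t \<subseteq> {w. length (letters w) = k}"
    using assms(1) unfolding ext_power_def by blast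
  have "P (wedge_of t)"
    using t(2)
  proof (induction t rule: frag_induction)
    case (one w)
    then show ?case using assms(3)[of "letters w"] by simp
  qed (simp_all add: wedge_of_simps assms)
  then show ?thesis by (simp add: t)
qed

lemma word_in_ext_power: "length l = k \<Longrightarrow> wedge_of (frag_of (Word l)) \<in> ext_power k"
  unfolding ext_power_def by (rule imageI) (simp add: keys_frag_of)

lemma frag_of_mult_ext_power:
  assumes "x \<in> ext_power k"
  shows "iota (frag_of n) * x \<in> ext_power (Suc k)"
  using assms
proof (induction rule: ext_power_induct)
  case (word l)
  have "iota (frag_of n) * wedge_of (frag_of (Word l)) = wedge_of (frag_of (Word (n # l)))"
    by (simp only: frag_of_Word_Cons[of n l] iota_frag_of wedge_of_simps)
  then show ?case using word_in_ext_power[of "n # l"] word by simp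
qed (simp_all add: zero_in_ext_power ext_power_diff right_diff_distrib)

lemma D_ext_power:
  assumes "x \<in> ext_power k"
  shows "D j x \<in> ext_power k"
  using assms
proof (induction rule: ext_power_induct)
  case (word l)
  then show ?case
  proof (induction l arbitrary: k j)
    case Nil
    then show ?case
      using word_in_ext_power[of "[]" k]
      unfolding frag_of_Word_Nil wedge_of_simps D_one
      by (cases "j = 0") (simp_all only: zero_in_ext_power if_True if_False simp_thms)
  next
    case (Cons n l)
    have "wedge_of (frag_of (Word (n # l))) = iota (frag_of n) * wedge_of (frag_of (Word l))"
      by (simp only: frag_of_Word_Cons[of n l] iota_frag_of wedge_of_simps)
    moreover have "iota (frag_of (n + i)) * D (j - i) (wedge_of (frag_of (Word l)))
        \<in> ext_power k" for i
      using frag_of_mult_ext_power[OF Cons.IH[OF refl]] Cons.prems by auto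
    ultimately show ?case
      by
        (simp only: D_mult D_iota shift_def frag_extend_of) (intro ext_power_sum)
  qed
qed (simp_all add: D_0 D_diff zero_in_ext_power ext_power_diff)

text \<open>
  Endomorphisms of the exterior power of degree \<open>k\<close> are functions on the whole type, made unique by
  extensionality; additivity is the same as \<open>\<int>\<close>-linearity.
\<close>

definition End_ext :: "nat \<Rightarrow> (ext \<Rightarrow> ext) ring" where
  "End_ext k =
    \<lparr>carrier = {f \<in> ext_power k \<rightarrow>\<^sub>E ext_power k.
        \<forall>x\<in>ext_power k. \<forall>y\<in>ext_power k. f (x + y) = f x + f y},
     mult = compose (ext_power k),
     one = (\<lambda>x\<in>ext_power k. x),
     zero = (\<lambda>x\<in>ext_power k. 0),
     add = (\<lambda>f g. \<lambda>x\<in>ext_power k. f x + g x)\<rparr>"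

definition D_op :: "nat \<Rightarrow> nat \<Rightarrow> ext \<Rightarrow> ext" where
  "D_op k j = (\<lambda>x\<in>ext_power k. D j x)"

definition intersection_ring :: "nat \<Rightarrow> (ext \<Rightarrow> ext) ring" where
  "intersection_ring k = (End_ext k)\<lparr>carrier := generate_ring (End_ext k) (D_op k ` {1..})\<rparr>"

lemma ring_End_ext: "ring (End_ext k)"
proof (rule ringI)
  let ?E = "End_ext k"
  show "abelian_group ?E"
  proof (rule abelian_groupI)
    fix f assume f: "f \<in> carrier ?E"
    have "(\<lambda>x\<in>ext_power k. - f x) \<in> carrier ?E"
      using f by (auto simp: End_ext_def PiE_iff ext_power_uminus ext_power_add)
    moreover have "(\<lambda>x\<in>ext_power k. - f x) \<oplus>\<^bsub>?E\<^esub> f = \<zero>\<^bsub>?E\<^esub>"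
      by (auto simp: End_ext_def)
    ultimately show "\<exists>g\<in>carrier ?E. g \<oplus>\<^bsub>?E\<^esub> f = \<zero>\<^bsub>?E\<^esub>" by blast
  qed (auto simp: End_ext_def PiE_iff extensional_def ext_power_add zero_in_ext_power
      add_ac fun_eq_iff)
  show "Group.monoid ?E"
    by (rule Group.monoidI)
      (auto simp: End_ext_def PiE_iff extensional_def compose_def ext_power_add fun_eq_iff)
qed (auto simp: End_ext_def PiE_iff extensional_def compose_def ext_power_add fun_eq_iff)

lemma D_op_in_End_ext: "D_op k j \<in> carrier (End_ext k)"
  by (auto simp: D_op_def End_ext_def D_ext_power D_add ext_power_add)

lemma (in ring) generate_ring_commute:
  assumes H: "H \<subseteq> carrier R" and c: "c \<in> carrier R"
    and comm: "\<And>h. h \<in> H \<Longrightarrow> h \<otimes> c = c \<otimes> h"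
    and x: "x \<in> generate_ring R H"
  shows "x \<otimes> c = c \<otimes> x"
  using x
proof (induction)
  case (a_inv h)
  then show ?case
    using c generate_ring_in_carrier[OF H] by (simp add: l_minus r_minus)
next
  case (eng_add h1 h2)
  then show ?case
    using c generate_ring_in_carrier[OF H] by (simp add: l_distr r_distr)
next
  case (eng_mult h1 h2)
  then show ?case
    using c generate_ring_in_carrier[OF H] by (metis m_assoc)
qed (use c comm in auto)

lemma cring_intersection_ring: "cring (intersection_ring k)"
proof -
  interpret E: ring "End_ext k" by (rule ring_End_ext)
  let ?H = "D_op k ` {1..}"
  have H: "?H \<subseteq> carrier (End_ext k)"
    using D_op_in_End_ext by blast
  have DD: "D_op k i \<otimes>\<^bsub>End_ext k\<^esub> D_op k j = D_op k j \<otimes>\<^bsub>End_ext k\<^esub> D_op k i" for i j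
    by (auto simp: End_ext_def compose_def D_op_def D_ext_power D_commute fun_eq_iff)
  have DG: "D_op k j \<otimes>\<^bsub>End_ext k\<^esub> x = x \<otimes>\<^bsub>End_ext k\<^esub> D_op k j"
    if "x \<in> generate_ring (End_ext k) ?H" for x j
    by (rule E.generate_ring_commute[OF H D_op_in_End_ext _ that, symmetric]) (use DD in blast)
  have "x \<otimes>\<^bsub>End_ext k\<^esub> y = y \<otimes>\<^bsub>End_ext k\<^esub> x"
    if "x \<in> generate_ring (End_ext k) ?H" "y \<in> generate_ring (End_ext k) ?H" for x y
    by (rule E.generate_ring_commute[OF H _ _ that(1)])
      (use that DG E.generate_ring_in_carrier[OF H] in blast)+
  then have "subcring (generate_ring (End_ext k) ?H) (End_ext k)"
    using E.generate_ring_is_subring[OF H] E.subcringI by blast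
  then show ?thesis
    unfolding intersection_ring_def by (rule E.subcring_iff[THEN iffD1, rotated])
      (use E.generate_ring_incl[OF H] in blast)
qed

text \<open>
  Polynomials over \<open>\<int>\<close> in indeterminates indexed by \<open>nat\<close> are the elements of
  \<open>(nat \<Rightarrow>\<^sub>0 nat) \<Rightarrow>\<^sub>0 int\<close>: finitely supported functions assigning coefficients to exponent vectors.
  Evaluation is meaningful only in a commutative ring.
\<close>

type_synonym int_mpoly = "(nat \<Rightarrow>\<^sub>0 nat) \<Rightarrow>\<^sub>0 int"

definition mpolys_in :: "nat set \<Rightarrow> int_mpoly set" where
  "mpolys_in I = {P. \<forall>m\<in>Poly_Mapping.keys P. Poly_Mapping.keys m \<subseteq> I}"

definition mpoly_eval :: "('a, 'b) ring_scheme \<Rightarrow> (nat \<Rightarrow> 'a) \<Rightarrow> int_mpoly \<Rightarrow> 'a" where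
  "mpoly_eval R x P =
    (\<Oplus>\<^bsub>R\<^esub>m\<in>Poly_Mapping.keys P. [Poly_Mapping.lookup P m] \<cdot>\<^bsub>R\<^esub>
      (\<Otimes>\<^bsub>R\<^esub>i\<in>Poly_Mapping.keys m. x i [^]\<^bsub>R\<^esub> Poly_Mapping.lookup m i))"

definition alg_independent :: "('a, 'b) ring_scheme \<Rightarrow> (nat \<Rightarrow> 'a) \<Rightarrow> nat set \<Rightarrow> bool" where
  "alg_independent R x I \<longleftrightarrow>
    x ` I \<subseteq> carrier R \<and> (\<forall>P\<in>mpolys_in I. mpoly_eval R x P = \<zero>\<^bsub>R\<^esub> \<longrightarrow> P = 0)"

end

theory Submission
  imports Defs "Jordan_Normal_Form.Determinant"
begin

text \<open>
  On a wedge of \<open>k\<close> basis vectors, the operator \<open>D j\<close> acts like multiplication by the complete homogeneous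
  symmetric polynomial of degree \<open>j\<close> in \<open>k\<close> variables, where the \<open>i\<close>-th variable shifts the index of the
  \<open>i\<close>-th factor.  The series with coefficients \<open>D_inv n\<close>, inverse to the series of all \<open>D j\<close>, then plays
  the role of the signed elementary symmetric polynomials.

  Generation.  The inverse series sends a vector \<open>m\<close> to \<open>m - t * shift 1 m\<close> and is multiplicative
  (\<open>D_inv_iota_mult\<close>), so on the \<open>k\<close>-th exterior power it is a polynomial in \<open>t\<close> of degree at most \<open>k\<close>
  (\<open>D_inv_eq_0\<close>).  The relation between a series and its inverse therefore expresses \<open>D n\<close> with \<open>n > k\<close>
  through \<open>D 0, \<dots>, D (n - 1)\<close> and \<open>D_inv 1, \<dots>, D_inv k\<close>, and each \<open>D_inv n\<close> with \<open>n \<le> k\<close> is itself a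
  polynomial in \<open>D 1, \<dots>, D n\<close> (\<open>D_op_in_generate_ring\<close>).

  Independence.  For every choice of integers \<open>d 1, \<dots>, d k\<close> there is an additive functional on the
  exterior algebra, with value \<open>1\<close> on the wedge of the first \<open>k\<close> basis vectors, which on the \<open>k\<close>-th
  exterior power is a simultaneous eigenvector of \<open>D 1, \<dots>, D k\<close> with eigenvalues \<open>d 1, \<dots>, d k\<close>
  (\<open>D_eigenfunctional\<close>).  It comes from the map of \<open>M\<close> onto the free module of rank \<open>k\<close>
  \<open>\<int>[X] / (X^k + c 1 * X^(k-1) + \<dots> + c k)\<close> that turns the shift into multiplication by \<open>X\<close>: the top exterior
  power of the quotient has rank one, and there \<open>D_inv n\<close> acts as the coefficient \<open>c n\<close> of the
  (reversed) characteristic polynomial of \<open>X\<close>.  Taking for \<open>c\<close> the coefficients of the inverse of the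
  power series with coefficients \<open>d\<close> produces the wanted eigenvalues.  A polynomial relation
  \<open>P (D 1, \<dots>, D k) = 0\<close> thus forces \<open>P (d 1, \<dots>, d k) = 0\<close> for all integers, hence \<open>P = 0\<close>.
\<close>

section \<open>The inverse of the shift series\<close>

text \<open>
  The inverse of \<open>\<Sum>j. D j * t ^ j\<close> as a power series in \<open>t\<close>, solved for its coefficients from the lowest upwards.
\<close>

function D_inv :: "nat \<Rightarrow> ext \<Rightarrow> ext" where
  "D_inv n x = (if n = 0 then x else - (\<Sum>i<n. D (n - i) (D_inv i x)))"
  by auto
termination by (relation "measure fst") auto

declare D_inv.simps [simp del]

lemma D_inv_0 [simp]: "D_inv 0 x = x"
  by (simp add: D_inv.simps)

lemma shift_0: "shift 0 m = m"
  by (induction m rule: frag_induct) (simp_all add: shift_def frag_extend_diff)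

lemma D_0_id: "D 0 x = x"
  by (induction x rule: ext_induct)
    (simp_all add: D_0 D_one D_iota shift_0 D_mult D_diff)

lemma sum_D_D_inv: "(\<Sum>i\<le>n. D (n - i) (D_inv i x)) = (if n = 0 then x else 0)"
proof (cases "n = 0")
  case False
  then show ?thesis
    by (simp add: D_inv.simps[of n] D_0_id flip: lessThan_Suc_atMost)
qed (simp add: D_0_id)

text \<open>
  As \<open>D 0\<close> is the identity, the convolution equations determine the coefficients one after the other.
  All identities for \<open>D_inv\<close> below come from this.
\<close>

lemma D_inv_unique:
  assumes "\<And>n. (\<Sum>i\<le>n. D (n - i) (E i)) = (if n = 0 then x else 0)"
  shows "E n = D_inv n x"
proof (induction n rule: less_induct)
  case (less n)
  have split: "(\<Sum>i\<le>n. D (n - i) (F i)) = (\<Sum>i<n. D (n - i) (F i)) + F n" for F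
    by (simp add: D_0_id flip: lessThan_Suc_atMost)
  have "(\<Sum>i<n. D (n - i) (E i)) = (\<Sum>i<n. D (n - i) (D_inv i x))"
    using less by (intro sum.cong) auto
  then show ?case
    using assms[of n] sum_D_D_inv[of n x] unfolding split by (metis add_left_cancel)
qed

text \<open>
  In \<open>D (Suc n)\<close> of a product with a vector \<open>m\<close>, either \<open>m\<close> stays fixed or it is shifted at least
  once, and one of the shifts may be carried out in advance.
\<close>

lemma D_Suc_iota_mult: "D (Suc n) (iota m * y) = iota m * D (Suc n) y + D n (iota (shift 1 m) * y)"
  unfolding D_mult sum.atLeast0_atMost_Suc_shift
  by (simp add: D_iota shift_0 shift_shift)

text \<open>
  This is the case of multiplicativity of the inverse series in which the left factor is a vector \<open>m\<close>,
  whose image under the series is the linear polynomial \<open>m - t * shift 1 m\<close>.  The right-hand side solves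
  the defining convolution equations: by \<open>D_Suc_iota_mult\<close>, the sum over the second summand cancels
  the terms in which \<open>m\<close> is shifted in the sum over the first one.
\<close>

lemma D_inv_iota_mult:
  "D_inv n (iota m * y) =
    iota m * D_inv n y - (if n = 0 then 0 else iota (shift 1 m) * D_inv (n - 1) y)"
proof -
  define E where "E n = iota m * D_inv n y -
    (if n = 0 then 0 else iota (shift 1 m) * D_inv (n - 1) y)" for n
  have "(\<Sum>i\<le>n. D (n - i) (E i)) = (if n = 0 then iota m * y else 0)" for n
  proof (cases n)
    case (Suc N)
    let ?S = "\<Sum>i\<le>N. D (N - i) (iota (shift 1 m) * D_inv i y)"
    have "(\<Sum>i\<le>n. D (n - i) (E i)) = (\<Sum>i\<le>n. D (n - i) (iota m * D_inv i y)) - ?S"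
      unfolding Suc E_def sum.atMost_Suc_shift[of _ N]
      by (simp add: D_diff sum_subtractf D_0)
    also have "(\<Sum>i\<le>n. D (n - i) (iota m * D_inv i y)) =
        (\<Sum>i\<le>N. iota m * D (n - i) (D_inv i y) + D (N - i) (iota (shift 1 m) * D_inv i y))
          + iota m * D_inv n y"
      unfolding Suc sum.atMost_Suc
      by (simp add: D_0_id Suc_diff_le D_Suc_iota_mult)
    also have "\<dots> = iota m * (\<Sum>i\<le>n. D (n - i) (D_inv i y)) + ?S"
      unfolding Suc sum.atMost_Suc
      by (simp add: D_0_id sum.distrib sum_distrib_left distrib_left)
    finally show ?thesis
      using Suc by (simp add: sum_D_D_inv)
  qed (simp add: E_def D_0_id)
  from D_inv_unique[OF this, of n] show ?thesis
    by (simp add: E_def)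
qed

abbreviation wedge :: "nat list \<Rightarrow> ext" where
  "wedge l \<equiv> wedge_of (frag_of (Word l))"

lemma wedge_Nil: "wedge [] = 1"
  unfolding frag_of_Word_Nil wedge_of_simps ..

lemma wedge_Cons: "wedge (n # l) = iota (frag_of n) * wedge l"
  by (simp only: frag_of_Word_Cons[of n l] iota_frag_of wedge_of_simps)

lemma wedge_append: "wedge (p @ l) = wedge p * wedge l"
  by (induction p) (simp_all only: append_Nil append_Cons wedge_Nil wedge_Cons mult_1_left mult.assoc)

lemma D_inv_wedge_Cons:
  "D_inv n (wedge (a # l)) = iota (frag_of a) * D_inv n (wedge l) -
    (if n = 0 then 0 else iota (frag_of (Suc a)) * D_inv (n - 1) (wedge l))"
  by (simp only: wedge_Cons D_inv_iota_mult shift_def frag_extend_of Suc_eq_plus1)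

lemma D_inv_diff: "D_inv n (x - y) = D_inv n x - D_inv n y"
  by (rule D_inv_unique[symmetric]) (simp add: D_diff sum_subtractf sum_D_D_inv)

lemma D_inv_zero: "D_inv n 0 = 0"
  using D_inv_diff[of n 0 0] by simp

lemma D_inv_one: "D_inv n 1 = (if n = 0 then 1 else 0)"
  by (rule D_inv_unique[symmetric]) (auto simp: if_distrib D_one D_0 cong: if_cong)

text \<open>
  Each factor contributes a polynomial of degree one in \<open>t\<close>.
\<close>

lemma D_inv_wedge_eq_0: "length l < n \<Longrightarrow> D_inv n (wedge l) = 0"
proof (induction l arbitrary: n)
  case Nil
  then show ?case by (simp add: wedge_Nil D_inv_one del: single_one)
next
  case (Cons a l)
  then show ?case
    unfolding D_inv_wedge_Cons using Cons.IH[of n] Cons.IH[of "n - 1"] by simp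
qed

lemma D_inv_eq_0:
  assumes "x \<in> ext_power k" "k < n"
  shows "D_inv n x = 0"
  using assms(1)
  by (induction rule: ext_power_induct)
    (use assms(2) in \<open>simp_all add: D_inv_zero D_inv_wedge_eq_0 D_inv_diff\<close>)

lemma D_inv_ext_power: "x \<in> ext_power k \<Longrightarrow> D_inv n x \<in> ext_power k"
proof (induction n rule: less_induct)
  case (less n)
  then show ?case
    by (cases "n = 0")
      (auto simp: D_inv.simps[of n] intro!: ext_power_uminus ext_power_sum D_ext_power)
qed

section \<open>Generation by the first k operators\<close>

lemma uminus_End_ext:
  assumes "f \<in> carrier (End_ext k)"
  shows "\<ominus>\<^bsub>End_ext k\<^esub> f = (\<lambda>x\<in>ext_power k. - f x)"
proof -
  interpret E: ring "End_ext k" by (rule ring_End_ext)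
  have "(\<lambda>x\<in>ext_power k. - f x) \<oplus>\<^bsub>End_ext k\<^esub> f = \<zero>\<^bsub>End_ext k\<^esub>"
    by (auto simp: End_ext_def)
  moreover have "(\<lambda>x\<in>ext_power k. - f x) \<in> carrier (End_ext k)"
    using assms by (auto simp: End_ext_def PiE_iff ext_power_uminus ext_power_add)
  ultimately show ?thesis
    using assms E.minus_equality by blast
qed

lemma sum_in_generate_ring:
  assumes "\<And>i. i \<in> A \<Longrightarrow> F i \<in> generate_ring (End_ext k) H"
  shows "(\<lambda>x\<in>ext_power k. \<Sum>i\<in>A. F i x) \<in> generate_ring (End_ext k) H"
proof -
  interpret E: ring "End_ext k" by (rule ring_End_ext)
  have zero: "(\<lambda>x\<in>ext_power k. 0) \<in> generate_ring (End_ext k) H"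
    using E.zero_in_generate[of H] by (simp add: End_ext_def)
  show ?thesis
    using assms
  proof (induction A rule: infinite_finite_induct)
    case (insert a A)
    have "F a \<oplus>\<^bsub>End_ext k\<^esub> (\<lambda>x\<in>ext_power k. \<Sum>i\<in>A. F i x) \<in> generate_ring (End_ext k) H"
      using insert by (intro generate_ring.eng_add) blast+
    also have "F a \<oplus>\<^bsub>End_ext k\<^esub> (\<lambda>x\<in>ext_power k. \<Sum>i\<in>A. F i x) =
        (\<lambda>x\<in>ext_power k. \<Sum>i\<in>insert a A. F i x)"
      using insert(1,2) by (auto simp: End_ext_def)
    finally show ?case .
  qed (simp_all add: zero)
qed

definition D_inv_op :: "nat \<Rightarrow> nat \<Rightarrow> ext \<Rightarrow> ext" where
  "D_inv_op k n = (\<lambda>x\<in>ext_power k. D_inv n x)"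

lemma convolution_in_generate_ring:
  assumes H: "H \<subseteq> carrier (End_ext k)"
    and D: "\<And>i. i \<in> A \<Longrightarrow> D_op k (n - i) \<in> generate_ring (End_ext k) H"
    and D_inv: "\<And>i. i \<in> A \<Longrightarrow> D_inv_op k i \<in> generate_ring (End_ext k) H"
  shows "(\<lambda>x\<in>ext_power k. - (\<Sum>i\<in>A. D (n - i) (D_inv i x))) \<in> generate_ring (End_ext k) H"
proof -
  interpret E: ring "End_ext k" by (rule ring_End_ext)
  define S where "S = (\<lambda>x\<in>ext_power k. \<Sum>i\<in>A. (D_op k (n - i) \<otimes>\<^bsub>End_ext k\<^esub> D_inv_op k i) x)"
  have S: "S \<in> generate_ring (End_ext k) H"
    unfolding S_def by (intro sum_in_generate_ring generate_ring.eng_mult D D_inv)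
  have "S = (\<lambda>x\<in>ext_power k. \<Sum>i\<in>A. D (n - i) (D_inv i x))"
    by (auto simp: S_def End_ext_def compose_def D_op_def D_inv_op_def D_inv_ext_power fun_eq_iff)
  then have "\<ominus>\<^bsub>End_ext k\<^esub> S = (\<lambda>x\<in>ext_power k. - (\<Sum>i\<in>A. D (n - i) (D_inv i x)))"
    using E.generate_ring_in_carrier[OF H S] by (auto simp: uminus_End_ext)
  then show ?thesis
    using generate_ring.a_inv[OF S] by simp
qed

lemma D_op_0: "D_op k 0 = \<one>\<^bsub>End_ext k\<^esub>"
  by (auto simp: D_op_def End_ext_def D_0_id)

text \<open>
  The relation \<open>\<Sum>i\<le>n. D (n - i) \<circ> D_inv i = 0\<close> is used twice.  Solved for \<open>D_inv n\<close> with \<open>n \<le> k\<close>, it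
  involves only \<open>D 1, \<dots>, D k\<close>.  Solved for \<open>D n\<close> with \<open>n > k\<close>, it reduces \<open>D n\<close> to operators of smaller
  index and to the \<open>D_inv i\<close>, which vanish for \<open>i > k\<close>.
\<close>

lemma D_op_in_generate_ring:
  "D_op k n \<in> generate_ring (End_ext k) (D_op k ` {1..k})"
proof -
  interpret E: ring "End_ext k" by (rule ring_End_ext)
  let ?H = "D_op k ` {1..k}"
  have H: "?H \<subseteq> carrier (End_ext k)"
    using D_op_in_End_ext by blast
  have low: "D_op k n \<in> generate_ring (End_ext k) ?H" if "n \<le> k" for n
    using that generate_ring.one[of "End_ext k" ?H]
    by (cases "n = 0") (auto simp: D_op_0 intro: generate_ring.incl)
  have inv: "D_inv_op k n \<in> generate_ring (End_ext k) ?H" for n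
  proof (induction n rule: less_induct)
    case (less n)
    consider "n = 0" | "n > k" | "0 < n" "n \<le> k" by linarith
    then show ?case
    proof cases
      case 1
      then have "D_inv_op k n = \<one>\<^bsub>End_ext k\<^esub>"
        by (simp add: D_inv_op_def End_ext_def)
      then show ?thesis by (simp add: generate_ring.one)
    next
      case 2
      then have "D_inv_op k n = \<zero>\<^bsub>End_ext k\<^esub>"
        by (auto simp: D_inv_op_def End_ext_def D_inv_eq_0)
      then show ?thesis by (simp add: E.zero_in_generate)
    next
      case 3
      then have "D_inv_op k n = (\<lambda>x\<in>ext_power k. - (\<Sum>i<n. D (n - i) (D_inv i x)))"
        by (simp add: D_inv_op_def D_inv.simps[of n])
      then show ?thesis
        using 3 less by (simp only:) (intro convolution_in_generate_ring[OF H] low; simp)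
    qed
  qed
  show ?thesis
  proof (induction n rule: less_induct)
    case (less n)
    show ?case
    proof (cases "n \<le> k")
      case False
      have "D n x = - (\<Sum>i=1..n. D (n - i) (D_inv i x))" for x
        using sum_D_D_inv[of n x] False
          sum.atLeast_Suc_atMost[of 0 n "\<lambda>i. D (n - i) (D_inv i x)"]
        by (simp add: atMost_atLeast0 eq_neg_iff_add_eq_0)
      then have "D_op k n = (\<lambda>x\<in>ext_power k. - (\<Sum>i=1..n. D (n - i) (D_inv i x)))"
        by (simp add: D_op_def)
      then show ?thesis
        using less by (simp only:) (intro convolution_in_generate_ring[OF H] inv; simp)
    qed (rule low)
  qed
qed

lemma generate_ring_D_op:
  "generate_ring (End_ext k) (D_op k ` {1..}) = generate_ring (End_ext k) (D_op k ` {1..k})"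
proof -
  interpret E: ring "End_ext k" by (rule ring_End_ext)
  have H: "D_op k ` A \<subseteq> carrier (End_ext k)" for A
    using D_op_in_End_ext by blast
  show ?thesis
  proof
    show "generate_ring (End_ext k) (D_op k ` {1..}) \<subseteq> generate_ring (End_ext k) (D_op k ` {1..k})"
      by (rule E.generate_ring_min_subring1[OF H E.generate_ring_is_subring[OF H]])
        (use D_op_in_generate_ring in blast)
    show "generate_ring (End_ext k) (D_op k ` {1..k}) \<subseteq> generate_ring (End_ext k) (D_op k ` {1..})"
      by (rule E.mono_generate_ring[OF _ H]) auto
  qed
qed

section \<open>Functionals on the exterior algebra\<close>

text \<open>
  The universal property of the exterior algebra, stated on the basis: \<open>alt\<close> and \<open>swap\<close> are what the
  vanishing of the extension on \<open>m \<otimes> m\<close> amounts to when \<open>m\<close> is a combination of basis vectors, the second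
  taking care of the mixed terms.
\<close>

lemma alternating_functional:
  fixes \<Phi> :: "nat list \<Rightarrow> 'a::ring_1"
  assumes alt: "\<And>p a q. \<Phi> (p @ [a, a] @ q) = 0"
    and swap: "\<And>p a b q. \<Phi> (p @ [a, b] @ q) = - \<Phi> (p @ [b, a] @ q)"
  obtains \<phi> where "\<And>x y. \<phi> (x - y) = \<phi> x - \<phi> y" "\<And>l. \<phi> (wedge l) = \<Phi> l"
proof -
  define T :: "tensor \<Rightarrow> 'a" where
    "T t = (\<Sum>w\<in>Poly_Mapping.keys t. of_int (Poly_Mapping.lookup t w) * \<Phi> (letters w))" for t
  have T_superset: "T t = (\<Sum>w\<in>A. of_int (Poly_Mapping.lookup t w) * \<Phi> (letters w))"
    if "finite A" "Poly_Mapping.keys t \<subseteq> A" for t A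
    unfolding T_def using that by (intro sum.mono_neutral_left) (auto simp: in_keys_iff)
  have T_diff: "T (s - t) = T s - T t" for s t
  proof -
    let ?A = "Poly_Mapping.keys s \<union> Poly_Mapping.keys t"
    have "Poly_Mapping.keys (s - t) \<subseteq> ?A"
      by (rule keys_diff)
    then show ?thesis
      by (simp add: T_superset[of ?A] lookup_minus left_diff_distrib sum_subtractf)
  qed
  have T_0: "T 0 = 0"
    by (simp add: T_def)
  have T_add: "T (s + t) = T s + T t" for s t
    using T_diff[of s "0 - t"] T_diff[of 0 t] by (simp add: T_0)
  have T_frag: "T (frag_of w) = \<Phi> (letters w)" for w
    by (simp add: T_def keys_frag_of)
  have vec_frag: "Defs.vec (frag_of n) = frag_of (Word [n])" for n
    by (simp add: Defs.vec_def)
  have vec_0: "Defs.vec 0 = 0" and vec_diff: "Defs.vec (m - m') = Defs.vec m - Defs.vec m'" for m m'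
    by (simp_all add: Defs.vec_def frag_extend_diff)
  have T_word: "T (frag_of u * Defs.vec (frag_of a) * Defs.vec (frag_of b) * frag_of v) =
      \<Phi> (letters u @ [a, b] @ letters v)" for u v a b
    by (simp only: vec_frag mult_single mult_1 plus_word_def word.sel T_frag append_assoc append_Cons append_Nil)
  have T_swap: "T (frag_of u * Defs.vec m * Defs.vec m' * frag_of v) =
      - T (frag_of u * Defs.vec m' * Defs.vec m * frag_of v)" for u v m m'
  proof (induction m rule: frag_induct)
    case (frag a)
    show ?case
    proof (induction m' rule: frag_induct)
      case (frag b)
      show ?case unfolding T_word by (rule swap)
    qed (simp_all add: vec_0 vec_diff T_0 T_diff algebra_simps)
  qed (simp_all add: vec_0 vec_diff T_0 T_diff algebra_simps)
  have T_square_frag: "T (frag_of u * Defs.vec m * Defs.vec m * frag_of v) = 0" for u v m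
  proof (induction m rule: frag_induct)
    case (frag a)
    show ?case unfolding T_word by (rule alt)
  next
    case (diff x y)
    then show ?case
      using T_swap[of u x y v] by (simp add: vec_diff T_diff T_add algebra_simps)
  qed (simp add: vec_0 T_0)
  have T_square: "T (u * Defs.vec m * Defs.vec m * v) = 0" for u v m
  proof (induction u rule: frag_induct)
    case (frag u)
    show ?case
    proof (induction v rule: frag_induct)
      case (frag v)
      show ?case by (rule T_square_frag)
    qed (simp_all add: T_0 T_diff right_diff_distrib)
  qed (simp_all add: T_0 T_diff left_diff_distrib)
  have T_ideal: "T t = 0" if "t \<in> alt_ideal" for t
    using that by (induction) (simp_all add: T_0 T_add T_square)
  define \<phi> where "\<phi> x = T (rep_ext x)" for x
  have \<phi>: "\<phi> (wedge_of t) = T t" for t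
  proof -
    have "ext_rel (rep_ext (wedge_of t)) t"
      by (metis Quotient3_abs_rep Quotient3_ext ext.abs_eq_iff)
    then show ?thesis
      using T_ideal T_diff unfolding \<phi>_def ext_rel_def by (metis eq_iff_diff_eq_0)
  qed
  show thesis
  proof
    show "\<phi> (x - y) = \<phi> x - \<phi> y" for x y
      by (metis \<phi> T_diff wedge_of_simps(4) Quotient3_abs_rep Quotient3_ext)
    show "\<phi> (wedge l) = \<Phi> l" for l
      unfolding \<phi> T_frag by simp
  qed
qed

text \<open>
  Rows are functions on all of \<open>nat\<close>, of which only the first \<open>k\<close> values count; this allows rows to be
  combined pointwise without dimension conditions.
\<close>

definition row_det :: "nat \<Rightarrow> (nat \<Rightarrow> 'a::comm_ring_1) list \<Rightarrow> 'a" where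
  "row_det k rs = det (mat k k (\<lambda>(i, j). (rs ! i) j))"

text \<open>
  In the Leibniz formula each summand contains exactly one entry of the row in question.
\<close>

lemma row_det_linear:
  assumes "length p < k"
  shows "row_det k (p @ [\<lambda>j. x j - t * y j] @ q) =
    row_det k (p @ [x] @ q) - t * row_det k (p @ [y] @ q)"
proof -
  let ?r = "length p" and ?R = "{0..<k} - {length p}"
  let ?C = "\<lambda>\<pi>. \<Prod>i\<in>?R. ((p @ [x] @ q) ! i) (\<pi> i)"
  have expand: "row_det k (p @ [z] @ q) =
      (\<Sum>\<pi> | \<pi> permutes {0..<k}. signof \<pi> * (z (\<pi> ?r) * ?C \<pi>))" for z
  proof -
    have "(\<Prod>i=0..<k. mat k k (\<lambda>(i, j). ((p @ [z] @ q) ! i) j) $$ (i, \<pi> i)) =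
        z (\<pi> ?r) * ?C \<pi>" if "\<pi> permutes {0..<k}" for \<pi>
    proof -
      have "(\<Prod>i=0..<k. mat k k (\<lambda>(i, j). ((p @ [z] @ q) ! i) j) $$ (i, \<pi> i)) =
          (\<Prod>i=0..<k. ((p @ [z] @ q) ! i) (\<pi> i))"
        using permutes_in_image[OF that] by (intro prod.cong) auto
      also have "\<dots> = z (\<pi> ?r) * (\<Prod>i\<in>?R. ((p @ [z] @ q) ! i) (\<pi> i))"
        using assms by (subst prod.remove[of _ ?r]) auto
      also have "(\<Prod>i\<in>?R. ((p @ [z] @ q) ! i) (\<pi> i)) = ?C \<pi>"
        by (intro prod.cong) (auto simp: nth_append nth_Cons split: nat.split)
      finally show ?thesis .
    qed
    then show ?thesis
      unfolding row_det_def by (subst det_def'[of _ k]) (auto intro!: sum.cong)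
  qed
  show ?thesis
    unfolding expand by (simp add: sum_distrib_left sum_subtractf algebra_simps)
qed

lemma row_det_repeat:
  assumes "length (p @ [x, x] @ q) = k"
  shows "row_det k (p @ [x, x] @ q) = 0"
  unfolding row_det_def
  by (rule det_identical_rows[of _ k "length p" "Suc (length p)"])
    (use assms in \<open>auto simp: nth_append intro!: eq_vecI\<close>)

text \<open>
  The usual polarization: the determinant vanishes when both rows are \<open>x - y\<close>.  The factor \<open>1\<close> only
  puts this difference into the form of \<open>row_det_linear\<close>.
\<close>

lemma row_det_swap:
  assumes "length (p @ [x, y] @ q) = k"
  shows "row_det k (p @ [x, y] @ q) = - row_det k (p @ [y, x] @ q)"
proof -
  have lin: "row_det k (p @ [\<lambda>j. a j - 1 * b j, z] @ q) =
      row_det k (p @ [a, z] @ q) - row_det k (p @ [b, z] @ q)"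
    "row_det k (p @ [z, \<lambda>j. a j - 1 * b j] @ q) =
      row_det k (p @ [z, a] @ q) - row_det k (p @ [z, b] @ q)" for a b z
    using row_det_linear[of p k a 1 b "z # q"] row_det_linear[of "p @ [z]" k a 1 b q] assms
    by simp_all
  have repeat: "row_det k (p @ [z, z] @ q) = 0" for z
    using row_det_repeat[of p z q k] assms by simp
  show ?thesis
    using repeat[of "\<lambda>j. x j - 1 * y j"] unfolding lin repeat
    by (metis diff_0 diff_0_right right_minus_eq minus_minus)
qed

section \<open>The shift modulo a monic polynomial\<close>

text \<open>
  The coordinates of \<open>X ^ n\<close> with respect to \<open>1, X, \<dots>, X ^ (k - 1)\<close> in the quotient of the polynomial ring
  by \<open>X ^ k + c 1 * X ^ (k - 1) + \<dots> + c k\<close>.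
\<close>

primrec power_residue :: "nat \<Rightarrow> (nat \<Rightarrow> 'a::comm_ring_1) \<Rightarrow> nat \<Rightarrow> nat \<Rightarrow> 'a" where
  "power_residue k c 0 = (\<lambda>j. if j = 0 then 1 else 0)"
| "power_residue k c (Suc n) = (\<lambda>j. (if j = 0 then 0 else power_residue k c n (j - 1)) -
      power_residue k c n (k - 1) * c (k - j))"

lemma power_residue_basis:
  "n < k \<Longrightarrow> j < k \<Longrightarrow> power_residue k c n j = (if j = n then 1 else 0)"
  by (induction n arbitrary: j) auto

text \<open>
  The matrix \<open>1 - t * K\<close>, where \<open>K\<close> is the companion matrix that describes multiplication by \<open>X\<close> on rows of
  coordinates.
\<close>

definition rev_char_mat :: "nat \<Rightarrow> (nat \<Rightarrow> 'a::comm_ring_1) \<Rightarrow> 'a \<Rightarrow> 'a mat" where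
  "rev_char_mat k c t = mat k k (\<lambda>(i, j). (if i = j then 1 else 0) - (if j = Suc i then t else 0) +
      (if i = k - 1 then t * c (k - j) else 0))"

text \<open>
  Apart from its last row, the matrix is upper bidiagonal.  Column operations, collected in the
  unitriangular matrix \<open>L\<close> of powers of \<open>t\<close>, clear the superdiagonal and gather the whole polynomial in
  the last diagonal entry.
\<close>

lemma det_rev_char_mat:
  assumes "k \<ge> 1" "c 0 = 1"
  shows "det (rev_char_mat k c t) = (\<Sum>n\<le>k. c n * t ^ n)"
proof -
  define L where "L = mat k k (\<lambda>(i, j). if i \<le> j then t ^ (j - i) else 0)"
  let ?N = "rev_char_mat k c t"
  have carr: "L \<in> carrier_mat k k" "?N \<in> carrier_mat k k"
    by (simp_all add: L_def rev_char_mat_def)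
  have entry: "(?N * L) $$ (i, j) = (\<Sum>h<k. ?N $$ (i, h) * L $$ (h, j))" if "i < k" "j < k" for i j
    using that carr by (simp add: scalar_prod_def lessThan_atLeast0)
  have upper: "(?N * L) $$ (i, j) = (if i = j then 1 else 0)" if "i < k - 1" "i \<le> j" "j < k" for i j
  proof -
    have "(?N * L) $$ (i, j) = (\<Sum>h<k. (if h = i then L $$ (i, j) else 0) -
        (if h = Suc i then t * L $$ (Suc i, j) else 0))"
      using that by (subst entry) (auto simp: rev_char_mat_def intro!: sum.cong)
    also have "\<dots> = L $$ (i, j) - t * L $$ (Suc i, j)"
      using that by (simp add: sum_subtractf)
    also have "\<dots> = (if i = j then 1 else 0)"
      using that by (auto simp: L_def Suc_diff_Suc simp flip: power_Suc)
    finally show ?thesis .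
  qed
  have corner: "(?N * L) $$ (k - 1, k - 1) = (\<Sum>n\<le>k. c n * t ^ n)"
  proof -
    have "(?N * L) $$ (k - 1, k - 1) =
        (\<Sum>h<k. (if h = k - 1 then 1 else 0) + t * c (k - h) * t ^ (k - 1 - h))"
      using assms(1) by (subst entry) (auto simp: rev_char_mat_def L_def intro!: sum.cong)
    also have "\<dots> = 1 + (\<Sum>h<k. c (k - h) * t ^ (k - h))"
    proof -
      have "t * c (k - h) * t ^ (k - 1 - h) = c (k - h) * t ^ (k - h)" if "h < k" for h
      proof -
        have "k - h = Suc (k - 1 - h)"
          using that by simp
        then show ?thesis by (metis mult.assoc mult.commute power_Suc)
      qed
      then show ?thesis
        using assms(1) by (simp add: sum.distrib)
    qed
    also have "(\<Sum>h<k. c (k - h) * t ^ (k - h)) = (\<Sum>n=1..k. c n * t ^ n)"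
      by (rule sum.reindex_bij_witness[of _ "\<lambda>n. k - n" "\<lambda>h. k - h"]) auto
    also have "1 + \<dots> = (\<Sum>n\<le>k. c n * t ^ n)"
      using assms(2) by (simp add: atMost_atLeast0 sum.atLeast_Suc_atMost)
    finally show ?thesis .
  qed
  have "det ?N * det L = det (?N * L)"
    using det_mult[OF carr(2,1)] by simp
  also have "\<dots> = prod_list (diag_mat (?N * L))"
    by (rule det_lower_triangular[of k]) (use carr upper in auto)
  also have "\<dots> = (\<Prod>i<k. (?N * L) $$ (i, i))"
    using carr by (simp add: prod_list_diag_prod lessThan_atLeast0)
  also have "\<dots> = (\<Prod>i<k - 1. (?N * L) $$ (i, i)) * (?N * L) $$ (k - 1, k - 1)"
    using assms(1) prod.lessThan_Suc[of "\<lambda>i. (?N * L) $$ (i, i)" "k - 1"] by simp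
  also have "\<dots> = (\<Sum>n\<le>k. c n * t ^ n)"
    using upper corner by simp
  finally have "det ?N * det L = (\<Sum>n\<le>k. c n * t ^ n)" .
  moreover have "det L = 1"
    using carr by (subst det_upper_triangular[of _ k]) (auto simp: L_def prod_list_diag_prod)
  ultimately show ?thesis by simp
qed

text \<open>
  Multiplication by \<open>1 - t * X\<close> acts on the top exterior power of the quotient as its determinant.
\<close>

lemma row_det_shift:
  assumes "k \<ge> 1" "c 0 = 1" "length l = k"
  shows "row_det k (map (\<lambda>a j. power_residue k c a j - t * power_residue k c (Suc a) j) l) =
    (\<Sum>n\<le>k. c n * t ^ n) * row_det k (map (power_residue k c) l)"
proof -
  let ?g = "power_residue k c" and ?N = "rev_char_mat k c t"
  let ?A = "mat k k (\<lambda>(i, j). (map ?g l ! i) j)"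
  have step: "(\<Sum>h<k. ?g a h * ?N $$ (h, j)) = ?g a j - t * ?g (Suc a) j" if "j < k" for a j
  proof -
    have "(\<Sum>h<k. ?g a h * ?N $$ (h, j)) = (\<Sum>h<k. (if h = j then ?g a h else 0)) -
        (\<Sum>h<k. if j = Suc h then t * ?g a h else 0) +
        (\<Sum>h<k. if h = k - 1 then t * (?g a h * c (k - j)) else 0)"
      unfolding sum_subtractf[symmetric] sum.distrib[symmetric]
      using that by (intro sum.cong) (simp_all add: rev_char_mat_def distrib_left right_diff_distrib)
    also have "(\<Sum>h<k. if j = Suc h then t * ?g a h else 0) = (if j = 0 then 0 else t * ?g a (j - 1))"
      using that by (cases j) simp_all
    also have "(\<Sum>h<k. if h = k - 1 then t * (?g a h * c (k - j)) else 0) =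
        t * (?g a (k - 1) * c (k - j))"
      using assms(1) by simp
    also have "(\<Sum>h<k. if h = j then ?g a h else 0) = ?g a j"
      using that by simp
    also have "?g a j - (if j = 0 then 0 else t * ?g a (j - 1)) + t * (?g a (k - 1) * c (k - j)) =
        ?g a j - t * ?g (Suc a) j"
      by (simp add: right_diff_distrib)
    finally show ?thesis .
  qed
  have "mat k k (\<lambda>(i, j). (map (\<lambda>a j. ?g a j - t * ?g (Suc a) j) l ! i) j) = ?A * ?N"
    using assms(3) step
    by (intro eq_matI) (auto simp: scalar_prod_def lessThan_atLeast0 rev_char_mat_def)
  moreover have "det (?A * ?N) = det ?A * det ?N"
    by (rule det_mult[of _ k]) (simp_all add: rev_char_mat_def)
  ultimately show ?thesis
    by (simp only: row_det_def det_rev_char_mat[of k c, OF assms(1,2)] mult.commute)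
qed

lemma power_residue_row_det_basis: "row_det k (map (power_residue k c) [0..<k]) = 1"
proof -
  have "mat k k (\<lambda>(i, j). (map (power_residue k c) [0..<k] ! i) j) = 1\<^sub>m k"
    by (intro eq_matI) (auto simp: power_residue_basis)
  then show ?thesis by (simp add: row_det_def)
qed

section \<open>Functionals with prescribed eigenvalues\<close>

lemma int_poly_coeffs_eq:
  fixes a b :: "nat \<Rightarrow> int"
  assumes "\<And>t. (\<Sum>n\<le>N. a n * t ^ n) = (\<Sum>n\<le>N. b n * t ^ n)" "n \<le> N"
  shows "a n = b n"
proof -
  define p where "p = (\<Sum>n\<le>N. monom (a n - b n) n)"
  have "poly p t = 0" for t
    using assms(1)[of t]
    by (simp add: p_def poly_sum poly_monom left_diff_distrib sum_subtractf)
  then have "p = 0"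
    using poly_all_0_iff_0 by blast
  moreover have "coeff p n = a n - b n"
    using assms(2) by (simp add: p_def coeff_sum)
  ultimately show ?thesis by simp
qed

text \<open>
  The coefficients of the inverse of the power series \<open>1 + d 1 * t + d 2 * t ^ 2 + \<dots>\<close>.
\<close>

function inv_coeffs :: "(nat \<Rightarrow> 'a::comm_ring_1) \<Rightarrow> nat \<Rightarrow> 'a" where
  "inv_coeffs d n = (if n = 0 then 1 else - (\<Sum>i<n. d (n - i) * inv_coeffs d i))"
  by auto
termination by (relation "measure snd") auto

declare inv_coeffs.simps [simp del]

text \<open>
  The functional is the determinant of the residues of the powers of \<open>X\<close>, that is, the projection onto
  the top exterior power of \<open>\<int>[X] / (X^k + c 1 * X^(k-1) + \<dots> + c k)\<close> with \<open>c = inv_coeffs d\<close>.  The operators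
  \<open>D_inv n\<close> act on it with eigenvalues \<open>c n\<close>; inverting the two power series in parallel turns this into
  the statement about \<open>D n\<close>.
\<close>

lemma D_eigenfunctional:
  fixes d :: "nat \<Rightarrow> int"
  assumes k: "k \<ge> 1"
  obtains \<phi> :: "ext \<Rightarrow> int" where "\<And>x y. \<phi> (x - y) = \<phi> x - \<phi> y" "\<phi> (wedge [0..<k]) = 1"
    "\<And>n w. w \<in> ext_power k \<Longrightarrow> n \<in> {1..k} \<Longrightarrow> \<phi> (D n w) = d n * \<phi> w"
proof -
  let ?c = "inv_coeffs d"
  have c0: "?c 0 = 1"
    by (simp add: inv_coeffs.simps)
  let ?g = "power_residue k ?c"
  define \<Phi> where "\<Phi> l = (if length l = k then row_det k (map ?g l) else 0)" for l
  have alt: "\<Phi> (p @ [a, a] @ q) = 0" for p a q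
    using row_det_repeat[of "map ?g p" "?g a" "map ?g q" k] by (simp add: \<Phi>_def)
  have swap: "\<Phi> (p @ [a, b] @ q) = - \<Phi> (p @ [b, a] @ q)" for p a b q
    using row_det_swap[of "map ?g p" "?g a" "?g b" "map ?g q" k] by (simp add: \<Phi>_def)
  obtain \<phi> where diff: "\<And>x y. \<phi> (x - y) = \<phi> x - \<phi> y" and \<phi>: "\<And>l. \<phi> (wedge l) = \<Phi> l"
    using alternating_functional[of \<Phi>, OF alt swap] by blast
  have zero: "\<phi> 0 = 0"
    using diff[of 0 0] by simp
  have add: "\<phi> (x + y) = \<phi> x + \<phi> y" for x y
    using diff[of x "0 - y"] diff[of 0 y] zero by simp
  have sum: "\<phi> (\<Sum>i\<in>A. F i) = (\<Sum>i\<in>A. \<phi> (F i))" for A and F :: "nat \<Rightarrow> ext"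
    by (induction A rule: infinite_finite_induct) (simp_all add: zero add)
  \<comment> \<open>The factors in \<open>p\<close> have not met the inverse series yet.  The recursion for \<open>D_inv\<close> moves the
    first factor of \<open>l\<close> to the end of \<open>p\<close>, once as \<open>X ^ a\<close> and once, with coefficient \<open>- t\<close>, as \<open>X ^ Suc a\<close>;
    linearity in this row merges the two determinants.\<close>
  have mixed: "(\<Sum>n\<le>length l. \<phi> (wedge p * D_inv n (wedge l)) * t ^ n) =
      row_det k (map ?g p @ map (\<lambda>a j. ?g a j - t * ?g (Suc a) j) l)"
    if "length p + length l = k" for p l t
    using that
  proof (induction l arbitrary: p)
    case Nil
    then show ?case
      by (simp add: wedge_Nil \<phi> \<Phi>_def del: single_one)
  next
    case (Cons a l)
    let ?L = "length l"
    let ?s = "map (\<lambda>a j. ?g a j - t * ?g (Suc a) j) l"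
    have rec: "\<phi> (wedge p * D_inv n (wedge (a # l))) =
        \<phi> (wedge (p @ [a]) * D_inv n (wedge l)) -
        (if n = 0 then 0 else \<phi> (wedge (p @ [Suc a]) * D_inv (n - 1) (wedge l)))" for n
      unfolding D_inv_wedge_Cons wedge_append wedge_Cons[of _ "[]"] wedge_Nil
      by (simp add: right_diff_distrib diff mult.assoc zero)
    have "(\<Sum>n\<le>length (a # l). \<phi> (wedge p * D_inv n (wedge (a # l))) * t ^ n) =
        (\<Sum>n\<le>Suc ?L. \<phi> (wedge (p @ [a]) * D_inv n (wedge l)) * t ^ n) -
        (\<Sum>n\<le>Suc ?L. (if n = 0 then 0 else
          \<phi> (wedge (p @ [Suc a]) * D_inv (n - 1) (wedge l))) * t ^ n)"
      unfolding rec by (simp only: list.size add_Suc_right add_0_right left_diff_distrib sum_subtractf)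
    also have "(\<Sum>n\<le>Suc ?L. \<phi> (wedge (p @ [a]) * D_inv n (wedge l)) * t ^ n) =
        (\<Sum>n\<le>?L. \<phi> (wedge (p @ [a]) * D_inv n (wedge l)) * t ^ n)"
      by (simp add: D_inv_wedge_eq_0 zero)
    also have "\<dots> = row_det k (map ?g p @ [?g a] @ ?s)"
      using Cons.IH[of "p @ [a]"] Cons.prems by simp
    also have "(\<Sum>n\<le>Suc ?L. (if n = 0 then 0 else
          \<phi> (wedge (p @ [Suc a]) * D_inv (n - 1) (wedge l))) * t ^ n) =
        t * (\<Sum>n\<le>?L. \<phi> (wedge (p @ [Suc a]) * D_inv n (wedge l)) * t ^ n)"
      unfolding sum.atMost_Suc_shift by (simp add: sum_distrib_left mult_ac)
    also have "\<dots> = t * row_det k (map ?g p @ [?g (Suc a)] @ ?s)"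
      using Cons.IH[of "p @ [Suc a]"] Cons.prems by simp
    finally show ?case
      using row_det_linear[of "map ?g p" k "?g a" t "?g (Suc a)" ?s] Cons.prems by simp
  qed
  \<comment> \<open>The case of empty \<open>p\<close> is an identity of polynomials in \<open>t\<close>, because it holds for all integers \<open>t\<close>.\<close>
  have D_inv: "\<phi> (D_inv n w) = ?c n * \<phi> w" if w: "w \<in> ext_power k" and n: "n \<le> k" for n w
    using w
  proof (induction rule: ext_power_induct)
    case (word l)
    have "(\<Sum>n\<le>k. \<phi> (D_inv n (wedge l)) * t ^ n) = (\<Sum>n\<le>k. ?c n * \<phi> (wedge l) * t ^ n)" for t
    proof -
      have "(\<Sum>n\<le>k. \<phi> (D_inv n (wedge l)) * t ^ n) = (\<Sum>n\<le>k. ?c n * t ^ n) * \<phi> (wedge l)"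
        using mixed[of "[]" l t] word row_det_shift[of k ?c l t] k c0
        by (simp add: wedge_Nil \<phi> \<Phi>_def del: single_one)
      then show ?thesis
        by (simp add: sum_distrib_left sum_distrib_right mult_ac)
    qed
    from int_poly_coeffs_eq[OF this n] show ?case .
  qed (simp_all add: D_inv_zero D_inv_diff zero diff algebra_simps)
  show thesis
  proof
    show "\<phi> (x - y) = \<phi> x - \<phi> y" for x y by (rule diff)
    show "\<phi> (wedge [0..<k]) = 1"
      unfolding \<phi> by (simp add: \<Phi>_def power_residue_row_det_basis)
    show "\<phi> (D n w) = d n * \<phi> w" if "w \<in> ext_power k" "n \<in> {1..k}" for n w
      using that
    proof (induction n arbitrary: w rule: less_induct)
      case (less n)
      have split: "(\<Sum>i\<le>n. F i) = F 0 + (\<Sum>i\<in>{1..<n}. F i) + F n" for F :: "nat \<Rightarrow> int"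
        using less.prems(2) sum.atLeast_Suc_atMost[of 0 n F] sum.last_plus[of 1 n F]
        by (simp add: atMost_atLeast0)
      have "0 = (\<Sum>i\<le>n. \<phi> (D (n - i) (D_inv i w)))"
        using sum_D_D_inv[of n w] less.prems(2) by (simp add: zero flip: sum)
      also have "\<dots> = \<phi> (D n w) + (\<Sum>i\<in>{1..<n}. d (n - i) * (?c i * \<phi> w)) + ?c n * \<phi> w"
        unfolding split using less D_inv[OF less.prems(1)]
        by (auto simp: D_0_id D_inv_ext_power intro!: sum.cong)
      finally have 1: "\<phi> (D n w) = - (\<Sum>i\<in>{1..<n}. d (n - i) * (?c i * \<phi> w)) - ?c n * \<phi> w"
        by simp
      \<comment> \<open>The recursion for \<open>?c n\<close>; its summand \<open>i = n\<close> has the factor \<open>1\<close> where the full sum has \<open>d 0\<close>.\<close>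
      have "0 = (\<Sum>i\<le>n. d (n - i) * ?c i) + (?c n - d 0 * ?c n)"
        using less.prems(2) by (simp add: inv_coeffs.simps[of d n] flip: lessThan_Suc_atMost)
      then have "d n = - (\<Sum>i\<in>{1..<n}. d (n - i) * ?c i) - ?c n"
        unfolding split by (simp add: c0)
      then show ?case
        unfolding 1 by (simp add: left_diff_distrib sum_distrib_right mult.assoc)
    qed
  qed
qed

section \<open>Integer polynomials vanishing everywhere\<close>

lemma digit_sum_inject:
  fixes f g :: "nat \<Rightarrow> nat"
  assumes "\<And>i. i < n \<Longrightarrow> f i < b" "\<And>i. i < n \<Longrightarrow> g i < b"
    and "(\<Sum>i<n. f i * b ^ i) = (\<Sum>i<n. g i * b ^ i)" "i < n"
  shows "f i = g i"
  using assms
proof (induction n arbitrary: f g i)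
  case (Suc n)
  have shift: "(\<Sum>i<Suc n. h i * b ^ i) = h 0 + b * (\<Sum>i<n. h (Suc i) * b ^ i)" for h :: "nat \<Rightarrow> nat"
    by (simp add: sum.lessThan_Suc_shift sum_distrib_left mult_ac del: sum.lessThan_Suc)
  have lt: "f 0 < b" "g 0 < b"
    using Suc.prems(1,2) by auto
  have eq: "f 0 + b * (\<Sum>i<n. f (Suc i) * b ^ i) = g 0 + b * (\<Sum>i<n. g (Suc i) * b ^ i)"
    using Suc.prems(3) unfolding shift .
  have 0: "f 0 = g 0"
    using arg_cong[OF eq, of "\<lambda>x. x mod b"] lt by simp
  have "(\<Sum>i<n. f (Suc i) * b ^ i) = (\<Sum>i<n. g (Suc i) * b ^ i)"
    using eq 0 lt by simp
  then have "f (Suc i) = g (Suc i)" if "i < n" for i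
    using Suc.IH[of "\<lambda>i. f (Suc i)" "\<lambda>i. g (Suc i)" i] Suc.prems(1,2) that by simp
  then show ?case
    using 0 Suc.prems(4) by (cases i) auto
qed simp

definition int_mpoly_value :: "(nat \<Rightarrow> int) \<Rightarrow> int_mpoly \<Rightarrow> int" where
  "int_mpoly_value d P = (\<Sum>m\<in>Poly_Mapping.keys P. Poly_Mapping.lookup P m *
      (\<Prod>i\<in>Poly_Mapping.keys m. d i ^ Poly_Mapping.lookup m i))"

text \<open>
  Kronecker substitution: for a base \<open>b\<close> above all exponents, the values \<open>d i = N ^ (b ^ i)\<close> turn distinct
  monomials of \<open>P\<close> into distinct powers of \<open>N\<close>, so that \<open>P\<close> becomes a polynomial in the single variable
  \<open>N\<close> with the same coefficients.
\<close>

lemma int_mpoly_eq_0: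
  assumes "\<And>d. int_mpoly_value d P = 0"
  shows "P = 0"
proof -
  let ?K = "Poly_Mapping.keys P"
  have "finite (\<Union>m\<in>?K. Poly_Mapping.keys m)"
    by simp
  then obtain n where n: "\<And>m. m \<in> ?K \<Longrightarrow> Poly_Mapping.keys m \<subseteq> {..<n}"
    by (auto simp: finite_nat_set_iff_bounded)
  have "finite (\<Union>m\<in>?K. Poly_Mapping.lookup m ` {..<n})"
    by simp
  then obtain b where "\<forall>e\<in>(\<Union>m\<in>?K. Poly_Mapping.lookup m ` {..<n}). e < b"
    unfolding finite_nat_set_iff_bounded by (rule exE)
  then have b: "Poly_Mapping.lookup m i < b" if "m \<in> ?K" "i < n" for m i
    using that by simp
  define code where "code m = (\<Sum>i<n. Poly_Mapping.lookup m i * b ^ i)" for m :: "nat \<Rightarrow>\<^sub>0 nat"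
  have inj: "m = m'" if m: "m \<in> ?K" "m' \<in> ?K" "code m = code m'" for m m'
  proof (rule poly_mapping_eqI)
    fix i
    show "Poly_Mapping.lookup m i = Poly_Mapping.lookup m' i"
    proof (cases "i < n")
      case True
      have "(\<Sum>i<n. Poly_Mapping.lookup m i * b ^ i) = (\<Sum>i<n. Poly_Mapping.lookup m' i * b ^ i)"
        using m(3) by (simp only: code_def)
      from digit_sum_inject[OF b[OF m(1)] b[OF m(2)] this True] show ?thesis .
    next
      case False
      then have "i \<notin> Poly_Mapping.keys m" "i \<notin> Poly_Mapping.keys m'"
        using n m by auto
      then show ?thesis by (simp add: in_keys_iff)
    qed
  qed
  define p where "p = (\<Sum>m\<in>?K. monom (Poly_Mapping.lookup P m) (code m))"
  have "poly p N = 0" for N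
  proof -
    have "(\<Prod>i\<in>Poly_Mapping.keys m. (N ^ (b ^ i)) ^ Poly_Mapping.lookup m i) = N ^ code m"
      if "m \<in> ?K" for m
    proof -
      have "(\<Prod>i\<in>Poly_Mapping.keys m. (N ^ (b ^ i)) ^ Poly_Mapping.lookup m i) =
          (\<Prod>i<n. (N ^ (b ^ i)) ^ Poly_Mapping.lookup m i)"
        using n[OF that] by (intro prod.mono_neutral_left) (auto simp: in_keys_iff)
      then show ?thesis
        by (simp add: code_def power_sum mult.commute flip: power_mult)
    qed
    then show ?thesis
      using assms[of "\<lambda>i. N ^ (b ^ i)"]
      by (simp add: int_mpoly_value_def p_def poly_sum poly_monom)
  qed
  then have "p = 0"
    using poly_all_0_iff_0 by blast
  have "Poly_Mapping.lookup P m = 0" if "m \<in> ?K" for m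
  proof -
    have "coeff p (code m) = (\<Sum>m'\<in>?K. if m' = m then Poly_Mapping.lookup P m' else 0)"
      unfolding p_def coeff_sum using inj that by (intro sum.cong) auto
    then show ?thesis
      using \<open>p = 0\<close> that by simp
  qed
  then show ?thesis
    by (intro poly_mapping_eqI) (metis in_keys_iff lookup_zero)
qed

section \<open>Algebraic independence\<close>

text \<open>
  Evaluation is built from the ring operations only, so it preserves every relation between ring
  elements and integers that the operations preserve.  The intended relation is that of an operator and
  its eigenvalue at a fixed functional.
\<close>

lemma (in cring) mpoly_eval_related:
  fixes rel :: "'a \<Rightarrow> int \<Rightarrow> bool"
  assumes carrier: "\<And>f a. rel f a \<Longrightarrow> f \<in> carrier R"
    and zero: "rel \<zero> 0" and one: "rel \<one> 1"
    and add: "\<And>f g a b. rel f a \<Longrightarrow> rel g b \<Longrightarrow> rel (f \<oplus> g) (a + b)"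
    and uminus: "\<And>f a. rel f a \<Longrightarrow> rel (\<ominus> f) (- a)"
    and mult: "\<And>f g a b. rel f a \<Longrightarrow> rel g b \<Longrightarrow> rel (f \<otimes> g) (a * b)"
    and x: "\<And>i. i \<in> I \<Longrightarrow> rel (x i) (d i)" and P: "P \<in> mpolys_in I"
  shows "rel (mpoly_eval R x P) (int_mpoly_value d P)"
proof -
  have pow: "rel (f [^] n) (a ^ n)" if "rel f a" for f a and n :: nat
    using that by (induction n) (auto simp: one mult mult.commute[of a])
  have scale_nat: "rel ([n] \<cdot> f) (int n * a)" if "rel f a" for f a and n :: nat
    using that by (induction n) (auto simp: zero add distrib_right add.commute[of a])
  have scale: "rel ([z] \<cdot> f) (z * a)" if f: "rel f a" for f a and z :: int
    using scale_nat[OF f, of "nat z"] uminus[OF scale_nat[OF f, of "nat (- z)"]]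
    by (cases "z < 0") (simp_all add: add_pow_int_ge add_pow_int_lt)
  have prod: "rel (\<Otimes>i\<in>A. F i) (\<Prod>i\<in>A. G i)"
    if "finite A" "\<And>i. i \<in> A \<Longrightarrow> rel (F i) (G i)" for A :: "nat set" and F G
    using that
  proof (induction A)
    case (insert j A)
    then have "F \<in> A \<rightarrow> carrier R" "F j \<in> carrier R"
      using carrier by blast+
    then show ?case
      using insert by (simp add: mult)
  qed (simp add: one)
  have sum: "rel (\<Oplus>i\<in>A. F i) (\<Sum>i\<in>A. G i)"
    if "finite A" "\<And>i. i \<in> A \<Longrightarrow> rel (F i) (G i)" for A :: "(nat \<Rightarrow>\<^sub>0 nat) set" and F G
    using that
  proof (induction A)
    case (insert j A)
    then have "F \<in> A \<rightarrow> carrier R" "F j \<in> carrier R"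
      using carrier by blast+
    then show ?case
      using insert by (simp add: add)
  qed (simp add: zero)
  show ?thesis
    unfolding mpoly_eval_def int_mpoly_value_def
    using P by (intro sum scale prod pow x) (auto simp: mpolys_in_def)
qed

text \<open>
  A polynomial relation among the operators, applied to the wedge of the first \<open>k\<close> basis vectors and
  followed by an eigenfunctional, becomes the vanishing of the polynomial at the eigenvalues, which are
  arbitrary integers.
\<close>

lemma alg_independent_D_op:
  assumes "k \<ge> 1"
  shows "alg_independent (intersection_ring k) (D_op k) {1..k}"
proof -
  interpret E: ring "End_ext k" by (rule ring_End_ext)
  interpret R: cring "intersection_ring k" by (rule cring_intersection_ring)
  have H: "D_op k ` {1..} \<subseteq> carrier (End_ext k)"
    using D_op_in_End_ext by blast
  have carrier: "carrier (intersection_ring k) = generate_ring (End_ext k) (D_op k ` {1..})"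
    and zero: "\<zero>\<^bsub>intersection_ring k\<^esub> = (\<lambda>x\<in>ext_power k. 0)"
    and one: "\<one>\<^bsub>intersection_ring k\<^esub> = (\<lambda>x\<in>ext_power k. x)"
    and add: "f \<oplus>\<^bsub>intersection_ring k\<^esub> g = (\<lambda>x\<in>ext_power k. f x + g x)"
    and mult: "f \<otimes>\<^bsub>intersection_ring k\<^esub> g = compose (ext_power k) f g" for f g
    by (simp_all add: intersection_ring_def End_ext_def)
  have maps: "f x \<in> ext_power k" if "f \<in> carrier (intersection_ring k)" "x \<in> ext_power k" for f x
  proof -
    have "f \<in> carrier (End_ext k)"
      using E.generate_ring_in_carrier[OF H] that(1) by (simp only: carrier)
    then show ?thesis
      using that(2) by (auto simp: End_ext_def)
  qed
  have D_op: "D_op k i \<in> carrier (intersection_ring k)" if "i \<in> {1..k}" for i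
    using that unfolding carrier by (intro generate_ring.incl) auto
  have "P = 0" if P: "P \<in> mpolys_in {1..k}"
    and eval: "mpoly_eval (intersection_ring k) (D_op k) P = \<zero>\<^bsub>intersection_ring k\<^esub>" for P
  proof (rule int_mpoly_eq_0)
    fix d :: "nat \<Rightarrow> int"
    obtain \<phi> :: "ext \<Rightarrow> int" where diff: "\<And>x y. \<phi> (x - y) = \<phi> x - \<phi> y"
      and unit: "\<phi> (wedge [0..<k]) = 1"
      and eigen: "\<And>n w. w \<in> ext_power k \<Longrightarrow> n \<in> {1..k} \<Longrightarrow> \<phi> (D n w) = d n * \<phi> w"
      using D_eigenfunctional[OF assms, of d] by blast
    have \<phi>_0: "\<phi> 0 = 0"
      using diff[of 0 0] by simp
    have \<phi>_add: "\<phi> (x + y) = \<phi> x + \<phi> y" for x y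
      using diff[of x "0 - y"] diff[of 0 y] \<phi>_0 by simp
    define rel where "rel f a \<longleftrightarrow> f \<in> carrier (intersection_ring k) \<and>
        (\<forall>w\<in>ext_power k. \<phi> (f w) = a * \<phi> w)" for f a
    have "rel (mpoly_eval (intersection_ring k) (D_op k) P) (int_mpoly_value d P)"
    proof (rule R.mpoly_eval_related[OF _ _ _ _ _ _ _ P])
      fix f a assume f: "rel f a"
      then have cancel: "f \<oplus>\<^bsub>intersection_ring k\<^esub> (\<ominus>\<^bsub>intersection_ring k\<^esub> f) = \<zero>\<^bsub>intersection_ring k\<^esub>"
        by (simp add: rel_def R.r_neg)
      have "f w + (\<ominus>\<^bsub>intersection_ring k\<^esub> f) w = 0" if "w \<in> ext_power k" for w
        using fun_cong[OF cancel[unfolded add zero], of w] that by simp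
      then have "\<phi> (f w) + \<phi> ((\<ominus>\<^bsub>intersection_ring k\<^esub> f) w) = 0" if "w \<in> ext_power k" for w
        using that \<phi>_0 by (simp flip: \<phi>_add)
      then have "\<phi> ((\<ominus>\<^bsub>intersection_ring k\<^esub> f) w) = - a * \<phi> w" if "w \<in> ext_power k" for w
        using f that unfolding rel_def by (simp add: eq_neg_iff_add_eq_0 add.commute)
      moreover have "\<ominus>\<^bsub>intersection_ring k\<^esub> f \<in> carrier (intersection_ring k)"
        using f unfolding rel_def by (intro R.a_inv_closed) simp
      ultimately show "rel (\<ominus>\<^bsub>intersection_ring k\<^esub> f) (- a)"
        unfolding rel_def by blast
    next
      show "rel \<zero>\<^bsub>intersection_ring k\<^esub> 0" "rel \<one>\<^bsub>intersection_ring k\<^esub> 1"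
        using R.zero_closed R.one_closed unfolding rel_def zero one by (simp_all add: \<phi>_0)
    next
      fix f g a b assume fg: "rel f a" "rel g b"
      then show "rel (f \<oplus>\<^bsub>intersection_ring k\<^esub> g) (a + b)"
        using R.a_closed[of f g] unfolding rel_def add by (simp add: \<phi>_add distrib_right)
      show "rel (f \<otimes>\<^bsub>intersection_ring k\<^esub> g) (a * b)"
        using fg R.m_closed[of f g] unfolding rel_def mult by (simp add: compose_eq maps)
    next
      fix i assume i: "i \<in> {1..k}"
      then have "\<phi> (D_op k i w) = d i * \<phi> w" if "w \<in> ext_power k" for w
        using that by (simp add: D_op_def eigen)
      then show "rel (D_op k i) (d i)"
        using D_op[OF i] unfolding rel_def by blast
    qed (simp add: rel_def)
    then have "\<phi> ((\<lambda>x\<in>ext_power k. 0) w) = int_mpoly_value d P * \<phi> w" if "w \<in> ext_power k" for w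
      using that by (simp add: rel_def eval zero)
    from this[of "wedge [0..<k]"] show "int_mpoly_value d P = 0"
      using word_in_ext_power[of "[0..<k]" k] by (simp add: unit \<phi>_0)
  qed
  then show ?thesis
    using D_op by (auto simp: alg_independent_def)
qed

theorem proposition3p9:
  fixes k :: nat
  assumes "k \<ge> 1"
  shows "carrier (intersection_ring k) = generate_ring (End_ext k) (D_op k ` {1..k}) \<and>
    alg_independent (intersection_ring k) (D_op k) {1..k}"
  using generate_ring_D_op[of k] alg_independent_D_op[OF assms]
  by (simp add: intersection_ring_def)

end
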